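(* Let $a\ge1$, $b,c\ge0$ and $n=a+b+c$. Let $K(a1^bc)$ be the barbell graph with vertices $r_1,\dots,r_a,s_1,\dots,s_b,t_1,\dots,t_c$ in which $\{r_1,\dots,r_a\}$ is a clique, $r_as_1s_2\cdots s_b$ is a path, and $\{s_b,t_1,\dots,t_c\}$ is a clique, where $s_b$ is to be read as $r_a$ if $b=0$. Then \[ X_{K(a1^bc)}=(a-1)!\,c!\Biggl(\sum_{\substack{I\vDash n,\ i_{-1}\ge a\\ i_1\ge c+1}}w_Ie_I+\sum_{\substack{I\vDash n,\ i_{-1}\ge a\\ i_1\le c<i_2}}(i_2-i_1)\prod_{j\ge3}(i_j-1)\,e_I\Biggr). \]
   Context: A composition $I=i_1\cdots i_s\vDash n$ is a sequence of positive integers with sum $n$; $i_{-1}=i_s$ is the last part; $e_I=e_{i_1}\cdots e_{i_s}$ (elementary symmetric functions); $w_I=i_1\prod_{j\ge2}(i_j-1)$. In the second sum, compositions have at least two parts. The chromatic symmetric function of a graph $G$ is $X_G=\sum_\kappa\prod_{v\in V(G)}x_{\kappa(v)}$ over proper colorings $\kappa:V(G)\to\{1,2,\dots\}$. *)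

theory Defs
  imports Complex_Main "HOL-Library.Multiset" "HOL-Library.FuncSet"
begin

text \<open>
  Formal power series in countably many commuting variables: a monomial is the finite
  multiset of its variable indices, and a series is an arbitrary function from monomials
  to coefficients.
\<close>

typedef 'a mseries = "UNIV :: (nat multiset \<Rightarrow> 'a) set"
  morphisms mcoeff Abs_mseries
  by simp

setup_lifting type_definition_mseries

lemma mseries_eqI: "(\<And>M. mcoeff f M = mcoeff g M) \<Longrightarrow> f = g"
  by transfer auto

lemma finite_submultisets [simp]: "finite {P. P \<subseteq># M}"
proof (rule finite_subset)
  show "{P. P \<subseteq># M} \<subseteq> mset ` {xs. set xs \<subseteq> set_mset M \<and> length xs \<le> size M}"
  proof
    fix P assume "P \<in> {P. P \<subseteq># M}"
    moreover obtain xs where "mset xs = P" using ex_mset by blast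
    ultimately show "P \<in> mset ` {xs. set xs \<subseteq> set_mset M \<and> length xs \<le> size M}"
      by (metis (mono_tags, lifting) image_eqI mem_Collect_eq set_mset_mono set_mset_mset
          size_mset size_mset_mono)
  qed
  show "finite (mset ` {xs. set xs \<subseteq> set_mset M \<and> length xs \<le> size M})"
    by (intro finite_imageI finite_lists_length_le) simp
qed

instantiation mseries :: (comm_ring_1) comm_ring_1
begin

lift_definition zero_mseries :: "'a mseries" is "\<lambda>_. 0" .

lift_definition one_mseries :: "'a mseries" is "\<lambda>M. if M = {#} then 1 else 0" .

lift_definition plus_mseries :: "'a mseries \<Rightarrow> 'a mseries \<Rightarrow> 'a mseries"
  is "\<lambda>f g M. f M + g M" .

lift_definition minus_mseries :: "'a mseries \<Rightarrow> 'a mseries \<Rightarrow> 'a mseries"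
  is "\<lambda>f g M. f M - g M" .

lift_definition uminus_mseries :: "'a mseries \<Rightarrow> 'a mseries"
  is "\<lambda>f M. - f M" .

lift_definition times_mseries :: "'a mseries \<Rightarrow> 'a mseries \<Rightarrow> 'a mseries"
  is "\<lambda>f g M. \<Sum>P \<in> {P. P \<subseteq># M}. f P * g (M - P)" .

instance
proof
  fix f g h :: "'a mseries"
  show "f * g * h = f * (g * h)"
  proof (rule mseries_eqI, transfer)
    fix f g h :: "nat multiset \<Rightarrow> 'a" and M
    have "(\<Sum>P | P \<subseteq># M. (\<Sum>Q | Q \<subseteq># P. f Q * g (P - Q)) * h (M - P))
        = (\<Sum>(P, Q) \<in> (SIGMA P:{P. P \<subseteq># M}. {Q. Q \<subseteq># P}). f Q * g (P - Q) * h (M - P))"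
      by (simp add: sum.Sigma sum_distrib_right)
    also have "\<dots> = (\<Sum>(Q, R) \<in> (SIGMA Q:{Q. Q \<subseteq># M}. {R. R \<subseteq># M - Q}).
        f Q * (g R * h (M - Q - R)))"
      by (rule sum.reindex_bij_witness[where i = "\<lambda>(Q, R). (Q + R, Q)"
              and j = "\<lambda>(P, Q). (Q, P - Q)"])
         (auto simp: mult.assoc subset_mset.add_diff_inverse subset_mset.le_diff_conv2
            subset_mset.diff_add add.commute
            intro: subset_mset.order_trans subset_eq_diff_conv)
    also have "\<dots> = (\<Sum>Q | Q \<subseteq># M. f Q * (\<Sum>R | R \<subseteq># M - Q. g R * h (M - Q - R)))"
      by (simp add: sum.Sigma sum_distrib_left)
    finally show "(\<Sum>P | P \<subseteq># M. (\<Sum>Q | Q \<subseteq># P. f Q * g (P - Q)) * h (M - P))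
        = (\<Sum>Q | Q \<subseteq># M. f Q * (\<Sum>R | R \<subseteq># M - Q. g R * h (M - Q - R)))" .
  qed
  show "f * g = g * f"
  proof (rule mseries_eqI, transfer)
    fix f g :: "nat multiset \<Rightarrow> 'a" and M
    show "(\<Sum>P | P \<subseteq># M. f P * g (M - P)) = (\<Sum>P | P \<subseteq># M. g P * f (M - P))"
      by (rule sum.reindex_bij_witness[where i = "\<lambda>P. M - P" and j = "\<lambda>P. M - P"])
         (auto simp: mult.commute subset_mset.diff_diff_right)
  qed
  show "1 * f = f"
  proof (rule mseries_eqI, transfer)
    fix f :: "nat multiset \<Rightarrow> 'a" and M
    have "(\<Sum>P | P \<subseteq># M. (if P = {#} then 1 else 0) * f (M - P))
        = (\<Sum>P \<in> {{#}}. (if P = {#} then 1 else 0) * f (M - P))"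
      by (rule sum.mono_neutral_right) auto
    then show "(\<Sum>P | P \<subseteq># M. (if P = {#} then 1 else 0) * f (M - P)) = f M"
      by simp
  qed
  show "(f + g) * h = f * h + g * h"
    by (rule mseries_eqI, transfer) (simp add: algebra_simps sum.distrib)
  show "(0 :: 'a mseries) \<noteq> 1"
    by transfer (metis zero_neq_one)
qed (transfer; simp add: algebra_simps; fail)+

end

lift_definition var :: "nat \<Rightarrow> 'a::comm_ring_1 mseries"
  is "\<lambda>i M. if M = {#i#} then 1 else 0" .

text \<open>
  The sum of a possibly infinite family of series, taken coefficientwise; it is meaningful
  when every monomial occurs in only finitely many members of the family.
\<close>

lift_definition formal_sum :: "'i set \<Rightarrow> ('i \<Rightarrow> 'a::comm_ring_1 mseries) \<Rightarrow> 'a mseries"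
  is "\<lambda>A f M. \<Sum>i | i \<in> A \<and> f i M \<noteq> 0. f i M" .

definition elem_sym :: "nat \<Rightarrow> 'a::comm_ring_1 mseries" where
  "elem_sym k = formal_sum {A. A \<subseteq> {1..} \<and> finite A \<and> card A = k} (\<lambda>A. \<Prod>i\<in>A. var i)"

definition elem_sym_list :: "nat list \<Rightarrow> 'a::comm_ring_1 mseries" where
  "elem_sym_list I = (\<Prod>i\<leftarrow>I. elem_sym i)"

definition proper_colorings :: "'v set \<Rightarrow> 'v set set \<Rightarrow> ('v \<Rightarrow> nat) set" where
  "proper_colorings V E = {\<kappa> \<in> V \<rightarrow>\<^sub>E {1..}. \<forall>u\<in>V. \<forall>v\<in>V. {u, v} \<in> E \<longrightarrow> \<kappa> u \<noteq> \<kappa> v}"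

definition chromatic_sym :: "'v set \<Rightarrow> 'v set set \<Rightarrow> 'a::comm_ring_1 mseries" where
  "chromatic_sym V E = formal_sum (proper_colorings V E) (\<lambda>\<kappa>. \<Prod>v\<in>V. var (\<kappa> v))"

definition compositions :: "nat \<Rightarrow> nat list set" where
  "compositions n = {I. (\<forall>i\<in>set I. i \<ge> 1) \<and> sum_list I = n}"

definition comp_weight :: "nat list \<Rightarrow> int" where
  "comp_weight I = int (hd I) * (\<Prod>i\<leftarrow>tl I. int i - 1)"

datatype barbell_vertex = R nat | S nat | T nat

text \<open>The vertex \<open>s\<^sub>j\<close>, with \<open>s\<^sub>0\<close> read as \<open>r\<^sub>a\<close>.\<close>

definition barbell_path_vertex :: "nat \<Rightarrow> nat \<Rightarrow> barbell_vertex" where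
  "barbell_path_vertex a j = (if j = 0 then R a else S j)"

definition clique_edges :: "'v set \<Rightarrow> 'v set set" where
  "clique_edges C = {{u, v} | u v. u \<in> C \<and> v \<in> C \<and> u \<noteq> v}"

definition barbell_verts :: "nat \<Rightarrow> nat \<Rightarrow> nat \<Rightarrow> barbell_vertex set" where
  "barbell_verts a b c = R ` {1..a} \<union> S ` {1..b} \<union> T ` {1..c}"

definition barbell_edges :: "nat \<Rightarrow> nat \<Rightarrow> nat \<Rightarrow> barbell_vertex set set" where
  "barbell_edges a b c =
     clique_edges (R ` {1..a})
     \<union> {{barbell_path_vertex a j, barbell_path_vertex a (Suc j)} | j. j < b}
     \<union> clique_edges (insert (barbell_path_vertex a b) (T ` {1..c}))"

lemma prod_var_eq:
  assumes "finite A"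
  shows "mcoeff (\<Prod>i\<in>A. var (f i) :: 'a::comm_ring_1 mseries) M
           = (if M = image_mset f (mset_set A) then 1 else 0)"
  using assms
proof (induction A arbitrary: M rule: finite_induct)
  case empty
  show ?case by (simp add: one_mseries.rep_eq)
next
  case (insert x A)
  have "mcoeff (\<Prod>i\<in>insert x A. var (f i) :: 'a mseries) M
      = (\<Sum>P | P \<subseteq># M. (if P = {#f x#} then 1 else 0) *
            (if M - P = image_mset f (mset_set A) then 1 else 0))"
    using insert by (simp add: times_mseries.rep_eq var.rep_eq)
  also have "\<dots> = (\<Sum>P \<in> {P. P \<subseteq># M} \<inter> {{#f x#}}.
            (if M - P = image_mset f (mset_set A) then 1 else 0))"
    by (rule sum.mono_neutral_cong_right) auto
  also have "\<dots> = (if M = image_mset f (mset_set (insert x A)) then 1 else 0)"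
  proof (cases "f x \<in># M")
    case True
    then obtain N where "M = add_mset (f x) N" by (metis insert_DiffM)
    then show ?thesis using insert by simp
  next
    case False
    then have "{P. P \<subseteq># M} \<inter> {{#f x#}} = {}" by auto
    moreover have "M \<noteq> image_mset f (mset_set (insert x A))" using False insert by auto
    ultimately show ?thesis by simp
  qed
  finally show ?case .
qed

lemma finite_elem_sym_support:
  "finite {A. (A \<subseteq> {1..} \<and> finite A \<and> card A = k)
              \<and> mcoeff (\<Prod>i\<in>A. var i :: 'a::comm_ring_1 mseries) M \<noteq> 0}"
  by (rule finite_subset[of _ "Pow (set_mset M)"])
     (auto simp: prod_var_eq split: if_splits)

lemma finite_chromatic_support:
  assumes "finite V"
  shows "finite {\<kappa>. \<kappa> \<in> proper_colorings V E
              \<and> mcoeff (\<Prod>v\<in>V. var (\<kappa> v) :: 'a::comm_ring_1 mseries) M \<noteq> 0}"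
proof (rule finite_subset)
  show "finite (V \<rightarrow>\<^sub>E set_mset M)"
    using assms by (intro finite_PiE) auto
qed (use assms in \<open>auto simp: proper_colorings_def prod_var_eq PiE_def split: if_splits\<close>)

lemma finite_compositions: "finite (compositions n)"
proof (rule finite_subset)
  have "length I \<le> sum_list I" if "\<forall>i\<in>set I. i \<ge> 1" for I :: "nat list"
    using that by (induction I) auto
  then show "compositions n \<subseteq> {I. set I \<subseteq> {..n} \<and> length I \<le> n}"
    by (auto simp: compositions_def dest: member_le_sum_list)
  show "finite {I. set I \<subseteq> {..n} \<and> length I \<le> n}"
    by (rule finite_lists_length_le) simp
qed

end

theory Submission
  imports Defs
begin

text \<open>
  Fix a finite set \<open>C\<close> of colours and write \<open>e\<^sub>k(C)\<close> for the elementary symmetric polynomial in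
  the variables \<open>x\<^sub>i\<close>, \<open>i \<in> C\<close>. Let \<open>W\<^sub>b(i)\<close> be the sum over the colourings of the lollipop (the
  barbell with \<open>c = 0\<close>) in which \<open>s\<^sub>b\<close> has colour \<open>i\<close>. Attaching a clique at \<open>s\<^sub>b\<close> shows that the
  barbell has the sum \<open>c! Y(b, c)\<close> with \<open>Y(b, c) = \<Sum>i. W\<^sub>b(i) e\<^sub>c(C - i)\<close>, and attaching an edge
  at \<open>s\<^sub>b\<close> that \<open>W\<^sub>b\<^sub>+\<^sub>1(i) = x\<^sub>i \<Sum>j\<noteq>i. W\<^sub>b(j)\<close>. Together with
  \<open>x\<^sub>i e\<^sub>c(C - i) = e\<^sub>c\<^sub>+\<^sub>1(C) - e\<^sub>c\<^sub>+\<^sub>1(C - i)\<close> and \<open>\<Sum>i. x\<^sub>i e\<^sub>c(C - i) = (c + 1) e\<^sub>c\<^sub>+\<^sub>1(C)\<close> this gives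
  \<open>Y(b + 1, c) = Y(b, c + 1) + c e\<^sub>c\<^sub>+\<^sub>1(C) Y(b, 0)\<close>.

  For \<open>b = 0\<close>, attaching a clique to a single vertex gives \<open>W\<^sub>0(i) = (a - 1)! x\<^sub>i e\<^sub>a\<^sub>-\<^sub>1(C - i)\<close>, and
  \<open>\<Sum>i. x\<^sub>i e\<^sub>p(C - i) e\<^sub>q(C - i)\<close> is expanded by trading \<open>q\<close> for \<open>p\<close>.

  The sum over compositions obeys the same recursion. Splitting off the first one or two parts
  expresses it through the sums \<open>P(m)\<close> of the products of \<open>(k - 1) e\<^sub>k\<close> over the remaining parts
  \<open>k\<close>. With \<open>f(i, j) = (j - i) e\<^sub>i e\<^sub>j P(n - i - j)\<close>, raising \<open>c\<close> changes the double sum of \<open>f\<close>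
  over \<open>i \<le> c < j\<close> by the whole row \<open>\<Sum>j. f(c + 1, j)\<close>, because \<open>f\<close> is antisymmetric, and the
  recursion \<open>P(m) = \<Sum>j. (j - 1) e\<^sub>j P(m - j)\<close> brings the difference to the required form. The
  passage to infinitely many colours is coefficientwise, since a monomial involves only finitely
  many variables.
\<close>

subsection \<open>Elementary symmetric polynomials\<close>

definition esym :: "('c \<Rightarrow> 'a::comm_ring_1) \<Rightarrow> 'c set \<Rightarrow> nat \<Rightarrow> 'a" where
  "esym x C k = (\<Sum>A | A \<subseteq> C \<and> card A = k. \<Prod>i\<in>A. x i)"

lemma esym_0:
  assumes "finite C"
  shows "esym x C 0 = 1"
proof -
  have "{A. A \<subseteq> C \<and> card A = 0} = {{}}"
    using assms by (auto dest: finite_subset)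
  then show ?thesis by (simp add: esym_def)
qed

lemma esym_empty_Suc: "esym x {} (Suc k) = 0"
  by (simp add: esym_def cong: conj_cong)

lemma esym_insert:
  assumes "finite C" "i \<notin> C"
  shows "esym x (insert i C) (Suc k) = esym x C (Suc k) + x i * esym x C k"
proof -
  let ?P = "{A. A \<subseteq> C \<and> card A = Suc k}" and ?Q = "{A. A \<subseteq> C \<and> card A = k}"
  have subset: "finite A" "i \<notin> A" if "A \<subseteq> C" for A
    using that assms finite_subset by auto
  have "{A \<in> Pow (insert i C). card A = Suc k} = ?P \<union> insert i ` ?Q"
    unfolding Pow_insert using subset by auto
  then have split: "{A. A \<subseteq> insert i C \<and> card A = Suc k} = ?P \<union> insert i ` ?Q"
    by simp
  have inj: "inj_on (insert i) ?Q"
    using subset by (auto simp: inj_on_def insert_ident)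
  have "esym x (insert i C) (Suc k) = (\<Sum>A\<in>?P. \<Prod>j\<in>A. x j) + (\<Sum>A\<in>insert i ` ?Q. \<Prod>j\<in>A. x j)"
    unfolding esym_def split using assms by (intro sum.union_disjoint) auto
  also have "(\<Sum>A\<in>insert i ` ?Q. \<Prod>j\<in>A. x j) = (\<Sum>A\<in>?Q. x i * (\<Prod>j\<in>A. x j))"
    using subset by (simp add: sum.reindex[OF inj])
  finally show ?thesis by (simp add: esym_def sum_distrib_left)
qed

lemma esym_remove:
  assumes "finite C" "i \<in> C"
  shows "esym x C (Suc k) = esym x (C - {i}) (Suc k) + x i * esym x (C - {i}) k"
  using esym_insert[of "C - {i}" i x k] assms by (simp add: insert_absorb)

lemma sum_esym_remove:
  assumes "finite C"
  shows "(\<Sum>i\<in>C. x i * esym x (C - {i}) k) = of_nat (Suc k) * esym x C (Suc k)"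
  using assms
proof (induction C arbitrary: k rule: finite_induct)
  case empty
  show ?case by (simp add: esym_empty_Suc)
next
  case (insert u C)
  have insert_minus: "insert u C - {i} = insert u (C - {i})" if "i \<in> C" for i
    using that insert.hyps by auto
  have "(\<Sum>i\<in>insert u C. x i * esym x (insert u C - {i}) k)
      = x u * esym x C k + (\<Sum>i\<in>C. x i * esym x (insert u (C - {i})) k)"
    using insert.hyps insert_minus by simp
  also have "\<dots> = of_nat (Suc k) * esym x (insert u C) (Suc k)"
  proof (cases k)
    case 0
    then show ?thesis
      using insert.hyps insert.IH[of 0] by (simp add: esym_0 esym_insert)
  next
    case (Suc l)
    have "(\<Sum>i\<in>C. x i * esym x (insert u (C - {i})) (Suc l))
        = (\<Sum>i\<in>C. x i * esym x (C - {i}) (Suc l)) + x u * (\<Sum>i\<in>C. x i * esym x (C - {i}) l)"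
      using insert.hyps
      by (simp add: esym_insert sum_distrib_left algebra_simps flip: sum.distrib)
    then show ?thesis
      using insert.hyps by (simp add: Suc insert.IH esym_insert algebra_simps)
  qed
  finally show ?case .
qed

lemma sum_esym_remove_esym_remove:
  fixes x :: "'c \<Rightarrow> 'a::comm_ring_1"
  assumes "finite C"
  shows "(\<Sum>i\<in>C. x i * esym x (C - {i}) p * esym x (C - {i}) q)
    = of_nat (p + q + 1) * esym x C (p + q + 1)
      + (\<Sum>r = 1..q. of_int (int (p + q + 1) - 2 * int r) * (esym x C r * esym x C (p + q + 1 - r)))"
proof (induction q arbitrary: p)
  case 0
  then show ?case
    using assms sum_esym_remove[OF assms, of x p] by (simp add: esym_0)
next
  case (Suc q)
  have "(\<Sum>i\<in>C. x i * esym x (C - {i}) p * esym x (C - {i}) (Suc q))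
      = (\<Sum>i\<in>C. (x i * esym x (C - {i}) p) * esym x C (Suc q)
         - (x i * esym x (C - {i}) q) * esym x C (Suc p)
         + x i * esym x (C - {i}) (Suc p) * esym x (C - {i}) q)"
    by (rule sum.cong)
       (simp_all add: esym_remove[OF assms, of _ x p] esym_remove[OF assms, of _ x q]
          algebra_simps)
  also have "\<dots> = of_nat (Suc p) * esym x C (Suc p) * esym x C (Suc q)
      - of_nat (Suc q) * esym x C (Suc q) * esym x C (Suc p)
      + (\<Sum>i\<in>C. x i * esym x (C - {i}) (Suc p) * esym x (C - {i}) q)"
    by (simp only: sum.distrib sum_subtractf sum_esym_remove[OF assms]
        flip: sum_distrib_right)
  also have "\<dots> = of_int (int p - int q) * (esym x C (Suc q) * esym x C (Suc p))
      + (\<Sum>i\<in>C. x i * esym x (C - {i}) (Suc p) * esym x (C - {i}) q)"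
    by (simp add: algebra_simps)
  finally show ?case
    unfolding Suc.IH by (simp add: add.left_commute)
qed

lemma sum_attach_edge_esym_remove:
  fixes x w :: "'c \<Rightarrow> 'a::comm_ring_1"
  assumes "finite C"
  shows "(\<Sum>i\<in>C. x i * (\<Sum>j\<in>C - {i}. w j) * esym x (C - {i}) c)
    = (\<Sum>i\<in>C. w i * esym x (C - {i}) (Suc c)) + of_nat c * (esym x C (Suc c) * (\<Sum>i\<in>C. w i))"
proof -
  have "(\<Sum>i\<in>C. x i * (\<Sum>j\<in>C - {i}. w j) * esym x (C - {i}) c)
     = (\<Sum>i\<in>C. x i * esym x (C - {i}) c * (\<Sum>j\<in>C. w j) - w i * esym x C (Suc c)
          + w i * esym x (C - {i}) (Suc c))"
    by (rule sum.cong)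
       (simp_all add: assms sum_diff1 esym_remove[OF assms, of _ x c] algebra_simps)
  also have "\<dots> = of_nat (Suc c) * esym x C (Suc c) * (\<Sum>j\<in>C. w j) - (\<Sum>j\<in>C. w j) * esym x C (Suc c)
      + (\<Sum>i\<in>C. w i * esym x (C - {i}) (Suc c))"
    by (simp only: sum.distrib sum_subtractf sum_esym_remove[OF assms] flip: sum_distrib_right)
  finally show ?thesis by (simp add: algebra_simps)
qed

subsection \<open>Rooted graphs and sums over their proper colourings\<close>

definition coloring_sum :: "('c \<Rightarrow> 'a::comm_ring_1) \<Rightarrow> 'v set \<Rightarrow> ('v \<Rightarrow> 'c) set \<Rightarrow> 'a" where
  "coloring_sum x V K = (\<Sum>\<kappa>\<in>K. \<Prod>v\<in>V. x (\<kappa> v))"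

definition proper_colorings_in :: "'c set \<Rightarrow> 'v set \<Rightarrow> 'v set set \<Rightarrow> ('v \<Rightarrow> 'c) set" where
  "proper_colorings_in C V E = {\<kappa> \<in> V \<rightarrow>\<^sub>E C. \<forall>u\<in>V. \<forall>v\<in>V. {u, v} \<in> E \<longrightarrow> \<kappa> u \<noteq> \<kappa> v}"

definition chromatic_sum :: "('c \<Rightarrow> 'a::comm_ring_1) \<Rightarrow> 'c set \<Rightarrow> 'v set \<Rightarrow> 'v set set \<Rightarrow> 'a" where
  "chromatic_sum x C V E = coloring_sum x V (proper_colorings_in C V E)"

definition rooted_chromatic_sum ::
  "('c \<Rightarrow> 'a::comm_ring_1) \<Rightarrow> 'c set \<Rightarrow> 'v set \<Rightarrow> 'v set set \<Rightarrow> 'v \<Rightarrow> 'c \<Rightarrow> 'a" where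
  "rooted_chromatic_sum x C V E u i = coloring_sum x V {\<kappa> \<in> proper_colorings_in C V E. \<kappa> u = i}"

lemma coloring_sum_by_color:
  assumes "finite K" "finite C" "\<And>\<kappa>. \<kappa> \<in> K \<Longrightarrow> \<kappa> u \<in> C"
  shows "coloring_sum x V K = (\<Sum>i\<in>C. coloring_sum x V {\<kappa> \<in> K. \<kappa> u = i})"
  unfolding coloring_sum_def using assms by (intro sum.group[symmetric]) auto

lemma coloring_sum_Un:
  assumes "finite V" "finite W" "V \<inter> W = {}" "A \<subseteq> extensional V" "B \<subseteq> extensional W"
  shows "coloring_sum x (V \<union> W) {\<kappa> \<in> extensional (V \<union> W). restrict \<kappa> V \<in> A \<and> restrict \<kappa> W \<in> B}
    = coloring_sum x V A * coloring_sum x W B"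
proof -
  let ?merge = "\<lambda>(\<alpha>, \<beta>) v. if v \<in> V then \<alpha> v else \<beta> v"
  have restrict_merge: "restrict (?merge (\<alpha>, \<beta>)) V = \<alpha>" "restrict (?merge (\<alpha>, \<beta>)) W = \<beta>"
    if "\<alpha> \<in> A" "\<beta> \<in> B" for \<alpha> \<beta>
    using that assms by (auto simp: extensional_def restrict_def fun_eq_iff)
  have "coloring_sum x V A * coloring_sum x W B
      = (\<Sum>(\<alpha>, \<beta>)\<in>A \<times> B. (\<Prod>v\<in>V. x (\<alpha> v)) * (\<Prod>v\<in>W. x (\<beta> v)))"
    by (simp add: coloring_sum_def sum_product sum.cartesian_product)
  also have "\<dots> = coloring_sum x (V \<union> W)
      {\<kappa> \<in> extensional (V \<union> W). restrict \<kappa> V \<in> A \<and> restrict \<kappa> W \<in> B}"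
    unfolding coloring_sum_def
  proof (rule sum.reindex_bij_witness[where i = "\<lambda>\<kappa>. (restrict \<kappa> V, restrict \<kappa> W)" and j = ?merge])
    fix \<kappa> assume "\<kappa> \<in> {\<kappa> \<in> extensional (V \<union> W). restrict \<kappa> V \<in> A \<and> restrict \<kappa> W \<in> B}"
    then show "?merge (restrict \<kappa> V, restrict \<kappa> W) = \<kappa>" "(restrict \<kappa> V, restrict \<kappa> W) \<in> A \<times> B"
      by (auto simp: extensional_def restrict_def fun_eq_iff)
  next
    fix p assume "p \<in> A \<times> B"
    then obtain \<alpha> \<beta> where p: "p = (\<alpha>, \<beta>)" "\<alpha> \<in> A" "\<beta> \<in> B" by auto
    then have "?merge p \<in> extensional (V \<union> W)"
      using assms by (auto simp: extensional_def)
    with p restrict_merge show "(restrict (?merge p) V, restrict (?merge p) W) = p"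
      "?merge p \<in> {\<kappa> \<in> extensional (V \<union> W). restrict \<kappa> V \<in> A \<and> restrict \<kappa> W \<in> B}"
      by auto
    have "(\<Prod>v\<in>W. x (?merge p v)) = (\<Prod>v\<in>W. x (\<beta> v))"
      using p assms by (intro prod.cong) auto
    then show "(\<Prod>v\<in>V \<union> W. x (?merge p v))
        = (case p of (\<alpha>, \<beta>) \<Rightarrow> (\<Prod>v\<in>V. x (\<alpha> v)) * (\<Prod>v\<in>W. x (\<beta> v)))"
      using p assms by (simp add: prod.union_disjoint)
  qed
  finally show ?thesis ..
qed

lemma coloring_sum_insert:
  assumes "finite V" "v \<notin> V" "A \<subseteq> extensional V"
  shows "coloring_sum x (insert v V) {\<kappa> \<in> extensional (insert v V). \<kappa> v = i \<and> restrict \<kappa> V \<in> A}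
    = x i * coloring_sum x V A"
proof -
  have "restrict \<kappa> {v} \<in> {\<lambda>_\<in>{v}. i} \<longleftrightarrow> \<kappa> v = i" for \<kappa>
    by (auto simp: restrict_def fun_eq_iff)
  then show ?thesis
    using coloring_sum_Un[of "{v}" V "{\<lambda>_\<in>{v}. i}" A x] assms
    by (simp add: coloring_sum_def)
qed

lemma inj_on_insert_iff_funcset:
  assumes "u \<notin> W"
  shows "inj_on \<kappa> (insert u W) \<longleftrightarrow> inj_on \<kappa> W \<and> \<kappa> \<in> W \<rightarrow> - {\<kappa> u}"
proof -
  have "\<kappa> u \<notin> \<kappa> ` W \<longleftrightarrow> \<kappa> \<in> W \<rightarrow> - {\<kappa> u}" by (simp add: Pi_iff image_iff) metis
  then show ?thesis using assms by simp
qed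

lemma coloring_sum_inj_on:
  fixes x :: "'c \<Rightarrow> 'a::comm_ring_1"
  assumes "finite W" "finite C"
  shows "coloring_sum x W {\<beta> \<in> W \<rightarrow>\<^sub>E C. inj_on \<beta> W} = of_nat (fact (card W)) * esym x C (card W)"
  using assms
proof (induction W arbitrary: C rule: finite_induct)
  case empty
  then show ?case by (simp add: coloring_sum_def esym_0)
next
  case (insert u W)
  let ?inj = "\<lambda>W C. {\<beta> \<in> W \<rightarrow>\<^sub>E C. inj_on \<beta> W}"
  have fiber: "{\<beta> \<in> ?inj (insert u W) C. \<beta> u = i}
      = {\<beta> \<in> extensional (insert u W). \<beta> u = i \<and> restrict \<beta> W \<in> ?inj W (C - {i})}" if "i \<in> C" for i
    using that insert.hyps
    by (auto simp: inj_on_insert_iff_funcset PiE_iff Pi_iff simp del: inj_on_insert)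
  have "finite (?inj (insert u W) C)"
    using insert.hyps insert.prems by (simp add: finite_PiE del: inj_on_insert)
  then have "coloring_sum x (insert u W) (?inj (insert u W) C)
      = (\<Sum>i\<in>C. coloring_sum x (insert u W) {\<beta> \<in> ?inj (insert u W) C. \<beta> u = i})"
    using insert.prems by (intro coloring_sum_by_color) auto
  also have "\<dots> = (\<Sum>i\<in>C. x i * (of_nat (fact (card W)) * esym x (C - {i}) (card W)))"
  proof (rule sum.cong[OF refl])
    fix i assume "i \<in> C"
    then show "coloring_sum x (insert u W) {\<beta> \<in> ?inj (insert u W) C. \<beta> u = i}
        = x i * (of_nat (fact (card W)) * esym x (C - {i}) (card W))"
      unfolding fiber[OF \<open>i \<in> C\<close>] using insert
      by (subst coloring_sum_insert) (auto simp: PiE_def)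
  qed
  also have "\<dots> = of_nat (fact (card W)) * (\<Sum>i\<in>C. x i * esym x (C - {i}) (card W))"
    by (simp add: sum_distrib_left mult.left_commute)
  finally show ?case
    using insert by (simp add: sum_esym_remove algebra_simps)
qed

lemma finite_proper_colorings_in:
  assumes "finite V" "finite C"
  shows "finite (proper_colorings_in C V E)"
  using assms by (simp add: proper_colorings_in_def finite_PiE)

lemma proper_colorings_in_extensional: "proper_colorings_in C V E \<subseteq> extensional V"
  by (auto simp: proper_colorings_in_def PiE_def)

lemma proper_colorings_in_mem:
  assumes "\<kappa> \<in> proper_colorings_in C V E" "u \<in> V"
  shows "\<kappa> u \<in> C"
  using assms by (auto simp: proper_colorings_in_def)

lemma chromatic_sum_by_root_color:
  assumes "finite V" "finite C" "u \<in> V"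
  shows "chromatic_sum x C V E = (\<Sum>i\<in>C. rooted_chromatic_sum x C V E u i)"
  unfolding chromatic_sum_def rooted_chromatic_sum_def using assms
  by (intro coloring_sum_by_color)
     (auto simp: finite_proper_colorings_in dest: proper_colorings_in_mem)

lemma rooted_chromatic_sum_single_vertex:
  assumes "i \<in> C"
  shows "rooted_chromatic_sum x C {u} {} u i = x i"
proof -
  have "{\<kappa> \<in> proper_colorings_in C {u} {}. \<kappa> u = i} = {u} \<rightarrow>\<^sub>E {i}"
  proof (intro equalityI subsetI)
    fix \<kappa> assume "\<kappa> \<in> {u} \<rightarrow>\<^sub>E {i}"
    then show "\<kappa> \<in> {\<kappa> \<in> proper_colorings_in C {u} {}. \<kappa> u = i}"
      using assms by (simp add: proper_colorings_in_def)
  qed (auto simp: proper_colorings_in_def PiE_iff simp del: ext_funcset_to_sing_iff)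
  then show ?thesis by (simp add: rooted_chromatic_sum_def coloring_sum_def)
qed

lemma rooted_chromatic_sum_attach_edge:
  assumes "finite C" "finite V" "\<Union>E \<subseteq> V" "u \<in> V" "v \<notin> V" "i \<in> C"
  shows "rooted_chromatic_sum x C (insert v V) (insert {u, v} E) v i
    = x i * (\<Sum>j\<in>C - {i}. rooted_chromatic_sum x C V E u j)"
proof -
  let ?K = "{\<kappa> \<in> proper_colorings_in C V E. \<kappa> u \<noteq> i}"
  have no_edge_at_v: "{v, w} \<notin> E" "{w, v} \<notin> E" for w using assms by auto
  have "\<kappa> \<in> proper_colorings_in C (insert v V) (insert {u, v} E) \<and> \<kappa> v = i
      \<longleftrightarrow> \<kappa> \<in> extensional (insert v V) \<and> \<kappa> v = i \<and> restrict \<kappa> V \<in> ?K" for \<kappa>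
    using assms no_edge_at_v by (auto simp: proper_colorings_in_def PiE_def Pi_def doubleton_eq_iff)
  then have "rooted_chromatic_sum x C (insert v V) (insert {u, v} E) v i
      = coloring_sum x (insert v V) {\<kappa> \<in> extensional (insert v V). \<kappa> v = i \<and> restrict \<kappa> V \<in> ?K}"
    by (simp add: rooted_chromatic_sum_def)
  also have "\<dots> = x i * coloring_sum x V ?K"
    using assms proper_colorings_in_extensional[of C V E] by (intro coloring_sum_insert) auto
  also have "coloring_sum x V ?K = (\<Sum>j\<in>C - {i}. coloring_sum x V {\<kappa> \<in> ?K. \<kappa> u = j})"
    using assms
    by (intro coloring_sum_by_color)
       (auto simp: finite_proper_colorings_in dest: proper_colorings_in_mem)
  also have "\<dots> = (\<Sum>j\<in>C - {i}. rooted_chromatic_sum x C V E u j)"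
    unfolding rooted_chromatic_sum_def
    by (intro sum.cong refl arg_cong[where f = "coloring_sum x V"]) auto
  finally show ?thesis .
qed

lemma proper_on_clique_iff:
  assumes "K \<subseteq> V"
  shows "(\<forall>u\<in>V. \<forall>v\<in>V. {u, v} \<in> clique_edges K \<longrightarrow> \<kappa> u \<noteq> \<kappa> v) \<longleftrightarrow> inj_on \<kappa> K"
  using assms by (fastforce simp: clique_edges_def inj_on_def doubleton_eq_iff)

lemma proper_colorings_in_attach_clique:
  assumes "V \<inter> W = {}" "\<Union>E \<subseteq> V" "u \<in> V"
  shows "\<kappa> \<in> proper_colorings_in C (V \<union> W) (E \<union> clique_edges (insert u W)) \<longleftrightarrow>
    \<kappa> \<in> extensional (V \<union> W) \<and> restrict \<kappa> V \<in> proper_colorings_in C V E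
    \<and> restrict \<kappa> W \<in> {\<beta> \<in> W \<rightarrow>\<^sub>E C - {\<kappa> u}. inj_on \<beta> W}"
proof -
  have "v \<in> V \<and> w \<in> V" if "{v, w} \<in> E" for v w
    using that assms(2) by auto
  then have "(\<forall>v\<in>V \<union> W. \<forall>w\<in>V \<union> W. {v, w} \<in> E \<longrightarrow> \<kappa> v \<noteq> \<kappa> w)
      \<longleftrightarrow> (\<forall>v\<in>V. \<forall>w\<in>V. {v, w} \<in> E \<longrightarrow> \<kappa> v \<noteq> \<kappa> w)"
    by blast
  moreover have "(\<forall>v\<in>V \<union> W. \<forall>w\<in>V \<union> W. {v, w} \<in> clique_edges (insert u W) \<longrightarrow> \<kappa> v \<noteq> \<kappa> w)
      \<longleftrightarrow> inj_on \<kappa> (insert u W)"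
    using assms(3) by (intro proper_on_clique_iff) auto
  ultimately have "\<kappa> \<in> proper_colorings_in C (V \<union> W) (E \<union> clique_edges (insert u W)) \<longleftrightarrow>
      \<kappa> \<in> V \<union> W \<rightarrow>\<^sub>E C \<and> (\<forall>v\<in>V. \<forall>w\<in>V. {v, w} \<in> E \<longrightarrow> \<kappa> v \<noteq> \<kappa> w)
      \<and> inj_on \<kappa> (insert u W)"
    unfolding proper_colorings_in_def by blast
  also have "\<kappa> \<in> V \<union> W \<rightarrow>\<^sub>E C \<longleftrightarrow> \<kappa> \<in> extensional (V \<union> W) \<and> \<kappa> \<in> V \<rightarrow> C \<and> \<kappa> \<in> W \<rightarrow> C"
    by (auto simp: PiE_def)
  also have "inj_on \<kappa> (insert u W) \<longleftrightarrow> inj_on \<kappa> W \<and> \<kappa> \<in> W \<rightarrow> - {\<kappa> u}"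
    using assms by (intro inj_on_insert_iff_funcset) auto
  finally show ?thesis
    by (auto simp: proper_colorings_in_def)
qed

lemma rooted_chromatic_sum_attach_clique:
  assumes "finite C" "finite V" "finite W" "V \<inter> W = {}" "\<Union>E \<subseteq> V" "u \<in> V"
  shows "rooted_chromatic_sum x C (V \<union> W) (E \<union> clique_edges (insert u W)) u i
    = rooted_chromatic_sum x C V E u i * (of_nat (fact (card W)) * esym x (C - {i}) (card W))"
proof -
  let ?K = "{\<kappa> \<in> proper_colorings_in C V E. \<kappa> u = i}"
  let ?L = "{\<beta> \<in> W \<rightarrow>\<^sub>E C - {i}. inj_on \<beta> W}"
  have "rooted_chromatic_sum x C (V \<union> W) (E \<union> clique_edges (insert u W)) u i
      = coloring_sum x (V \<union> W) {\<kappa> \<in> extensional (V \<union> W). restrict \<kappa> V \<in> ?K \<and> restrict \<kappa> W \<in> ?L}"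
    unfolding rooted_chromatic_sum_def proper_colorings_in_attach_clique[OF assms(4-6)]
    using assms(6) by (intro arg_cong[where f = "coloring_sum x (V \<union> W)"]) auto
  also have "\<dots> = coloring_sum x V ?K * coloring_sum x W ?L"
    using assms proper_colorings_in_extensional[of C V E]
    by (intro coloring_sum_Un) (auto simp: PiE_def)
  finally show ?thesis
    using assms by (simp add: rooted_chromatic_sum_def coloring_sum_inj_on)
qed

subsection \<open>Sums over compositions\<close>

lemma sum_compositions_Cons:
  assumes "n > 0"
  shows "(\<Sum>I | I \<in> compositions n \<and> P I. f I)
    = (\<Sum>i = 1..n. \<Sum>J | J \<in> compositions (n - i) \<and> P (i # J). f (i # J))"
proof -
  let ?S = "SIGMA i:{1..n}. {J. J \<in> compositions (n - i) \<and> P (i # J)}"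
  have "(\<Sum>I | I \<in> compositions n \<and> P I. f I) = (\<Sum>(i, J)\<in>?S. f (i # J))"
  proof (rule sum.reindex_bij_witness[where i = "\<lambda>(i, J). i # J" and j = "\<lambda>I. (hd I, tl I)"])
    fix I assume I: "I \<in> {I \<in> compositions n. P I}"
    with assms obtain i J where "I = i # J" by (cases I) (auto simp: compositions_def)
    with I show "(hd I, tl I) \<in> ?S" "(case (hd I, tl I) of (i, J) \<Rightarrow> i # J) = I"
      "(case (hd I, tl I) of (i, J) \<Rightarrow> f (i # J)) = f I"
      by (auto simp: compositions_def)
  qed (auto simp: compositions_def)
  then show ?thesis by (simp add: sum.Sigma finite_compositions)
qed

lemma compositions_0: "compositions 0 = {[]}"
proof -
  have "I = []" if "I \<in> compositions 0" for I
    using that by (cases I) (auto simp: compositions_def)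
  then show ?thesis by (auto simp: compositions_def)
qed

lemma last_Cons_composition_ge_iff:
  assumes "J \<in> compositions (n - i)" "i \<le> n" "a \<le> n"
  shows "a \<le> last (i # J) \<longleftrightarrow> J = [] \<or> a \<le> last J"
  using assms by (auto simp: compositions_def)

definition tail_sum :: "(nat \<Rightarrow> 'a::comm_ring_1) \<Rightarrow> nat \<Rightarrow> nat \<Rightarrow> 'a" where
  "tail_sum e a m = (\<Sum>K | K \<in> compositions m \<and> (K = [] \<or> a \<le> last K).
     of_int (\<Prod>k\<leftarrow>K. int k - 1) * (\<Prod>k\<leftarrow>K. e k))"

lemma tail_sum_0: "tail_sum e a 0 = 1"
proof -
  have "{K. K \<in> compositions 0 \<and> (K = [] \<or> a \<le> last K)} = {[]}"
    by (auto simp: compositions_0)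
  then show ?thesis by (simp add: tail_sum_def)
qed

lemma tail_sum_eq_0:
  assumes "0 < m" "m < a"
  shows "tail_sum e a m = 0"
proof -
  have "\<not> a \<le> last K" "K \<noteq> []" if "K \<in> compositions m" for K
  proof -
    show "K \<noteq> []" using that assms by (auto simp: compositions_def)
    then have "last K \<le> sum_list K" by (intro member_le_sum_list) auto
    then show "\<not> a \<le> last K" using that assms by (simp add: compositions_def)
  qed
  then show ?thesis
    by (auto simp: tail_sum_def intro!: sum.neutral)
qed

lemma tail_sum_Cons:
  assumes "i \<le> n" "a \<le> n"
  shows "(\<Sum>J | J \<in> compositions (n - i) \<and> a \<le> last (i # J).
      of_int (h * (\<Prod>k\<leftarrow>J. int k - 1)) * (\<Prod>k\<leftarrow>i # J. e k))
    = of_int h * e i * tail_sum e a (n - i)"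
proof -
  have "{J. J \<in> compositions (n - i) \<and> a \<le> last (i # J)}
      = {J. J \<in> compositions (n - i) \<and> (J = [] \<or> a \<le> last J)}"
    using last_Cons_composition_ge_iff assms by blast
  then show ?thesis
    by (simp add: tail_sum_def sum_distrib_left mult_ac)
qed

lemma tail_sum_rec:
  assumes "1 \<le> a" "a \<le> m"
  shows "tail_sum e a m = (\<Sum>j = 1..m. of_int (int j - 1) * e j * tail_sum e a (m - j))"
proof -
  have "{K. K \<in> compositions m \<and> (K = [] \<or> a \<le> last K)} = {K. K \<in> compositions m \<and> a \<le> last K}"
    using assms by (auto simp: compositions_def)
  then have "tail_sum e a m = (\<Sum>j = 1..m. \<Sum>J | J \<in> compositions (m - j) \<and> a \<le> last (j # J).
      of_int ((int j - 1) * (\<Prod>k\<leftarrow>J. int k - 1)) * (\<Prod>k\<leftarrow>j # J. e k))"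
    using assms by (simp add: tail_sum_def sum_compositions_Cons del: of_int_mult)
  also have "\<dots> = (\<Sum>j = 1..m. of_int (int j - 1) * e j * tail_sum e a (m - j))"
    using assms by (intro sum.cong refl tail_sum_Cons) auto
  finally show ?thesis .
qed

definition barbell_expansion :: "(nat \<Rightarrow> 'a::comm_ring_1) \<Rightarrow> nat \<Rightarrow> nat \<Rightarrow> nat \<Rightarrow> 'a" where
  "barbell_expansion e a c n =
     (\<Sum>I | I \<in> compositions n \<and> last I \<ge> a \<and> hd I \<ge> c + 1.
        of_int (comp_weight I) * (\<Prod>i\<leftarrow>I. e i))
     + (\<Sum>I | I \<in> compositions n \<and> length I \<ge> 2 \<and> last I \<ge> a \<and> hd I \<le> c \<and> c < I ! 1.
        of_int ((int (I ! 1) - int (hd I)) * (\<Prod>i\<leftarrow>drop 2 I. int i - 1)) * (\<Prod>i\<leftarrow>I. e i))"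

lemma sum_compositions_large_head:
  assumes "1 \<le> a" "a \<le> n"
  shows "(\<Sum>I | I \<in> compositions n \<and> last I \<ge> a \<and> hd I \<ge> c + 1.
      of_int (comp_weight I) * (\<Prod>i\<leftarrow>I. e i))
    = (\<Sum>i = Suc c..n. of_nat i * e i * tail_sum e a (n - i))"
proof -
  let ?f = "\<lambda>I. of_int (comp_weight I) * (\<Prod>i\<leftarrow>I. e i)"
  have "(\<Sum>I | I \<in> compositions n \<and> last I \<ge> a \<and> hd I \<ge> c + 1. ?f I)
      = (\<Sum>i = 1..n. \<Sum>J | J \<in> compositions (n - i) \<and> a \<le> last (i # J) \<and> c + 1 \<le> i. ?f (i # J))"
    using assms by (simp add: sum_compositions_Cons)
  also have "\<dots> = (\<Sum>i = Suc c..n. of_nat i * e i * tail_sum e a (n - i))"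
  proof (rule sum.mono_neutral_cong_right)
    fix i assume "i \<in> {Suc c..n}"
    then show "(\<Sum>J | J \<in> compositions (n - i) \<and> a \<le> last (i # J) \<and> c + 1 \<le> i. ?f (i # J))
        = of_nat i * e i * tail_sum e a (n - i)"
      using tail_sum_Cons[of i n a "int i" e] assms by (simp add: comp_weight_def)
  qed auto
  finally show ?thesis .
qed

lemma sum_compositions_small_head:
  assumes "1 \<le> a" "a + c \<le> n"
  shows "(\<Sum>I | I \<in> compositions n \<and> length I \<ge> 2 \<and> last I \<ge> a \<and> hd I \<le> c \<and> c < I ! 1.
      of_int ((int (I ! 1) - int (hd I)) * (\<Prod>i\<leftarrow>drop 2 I. int i - 1)) * (\<Prod>i\<leftarrow>I. e i))
    = (\<Sum>i = 1..c. \<Sum>j = Suc c..n - i.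
        of_int (int j - int i) * e i * e j * tail_sum e a (n - i - j))"
proof -
  let ?f = "\<lambda>I. of_int ((int (I ! 1) - int (hd I)) * (\<Prod>i\<leftarrow>drop 2 I. int i - 1)) * (\<Prod>i\<leftarrow>I. e i)"
  let ?P = "\<lambda>I. length I \<ge> 2 \<and> last I \<ge> a \<and> hd I \<le> c \<and> c < I ! 1"
  have "(\<Sum>I | I \<in> compositions n \<and> ?P I. ?f I)
      = (\<Sum>i = 1..n. \<Sum>J | J \<in> compositions (n - i) \<and> ?P (i # J). ?f (i # J))"
    using assms by (intro sum_compositions_Cons) auto
  also have "\<dots> = (\<Sum>i = 1..c. \<Sum>J | J \<in> compositions (n - i) \<and> ?P (i # J). ?f (i # J))"
    using assms by (intro sum.mono_neutral_right) auto
  also have "\<dots> = (\<Sum>i = 1..c. \<Sum>j = Suc c..n - i.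
      of_int (int j - int i) * e i * e j * tail_sum e a (n - i - j))"
  proof (rule sum.cong[OF refl])
    fix i assume i: "i \<in> {1..c}"
    then have "a \<le> n - i" using assms by auto
    from i have "(\<Sum>J | J \<in> compositions (n - i) \<and> ?P (i # J). ?f (i # J))
        = (\<Sum>j = 1..n - i. \<Sum>K | K \<in> compositions (n - i - j) \<and> ?P (i # j # K). ?f (i # j # K))"
      using assms by (intro sum_compositions_Cons) auto
    also have "\<dots> = (\<Sum>j = Suc c..n - i.
        of_int (int j - int i) * e i * e j * tail_sum e a (n - i - j))"
    proof (rule sum.mono_neutral_cong_right)
      fix j assume "j \<in> {Suc c..n - i}"
      then show "(\<Sum>K | K \<in> compositions (n - i - j) \<and> ?P (i # j # K). ?f (i # j # K))
          = of_int (int j - int i) * e i * e j * tail_sum e a (n - i - j)"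
        using tail_sum_Cons[of j "n - i" a "int j - int i" e] \<open>a \<le> n - i\<close> i
        by (simp add: last_ConsR mult_ac del: last.simps flip: sum_distrib_left)
    qed auto
    finally show "(\<Sum>J | J \<in> compositions (n - i) \<and> ?P (i # J). ?f (i # J))
        = (\<Sum>j = Suc c..n - i. of_int (int j - int i) * e i * e j * tail_sum e a (n - i - j))" .
  qed
  finally show ?thesis .
qed

lemma barbell_expansion_eq_tail_sums:
  assumes "1 \<le> a" "a + c \<le> n"
  shows "barbell_expansion e a c n = (\<Sum>i = Suc c..n. of_nat i * e i * tail_sum e a (n - i))
    + (\<Sum>i = 1..c. \<Sum>j = Suc c..n - i.
        of_int (int j - int i) * e i * e j * tail_sum e a (n - i - j))"
  using sum_compositions_large_head[of a n e c] sum_compositions_small_head[of a c n e] assms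
  by (simp add: barbell_expansion_def)

lemma sum_rectangle_Suc_antisymmetric:
  fixes f :: "nat \<Rightarrow> nat \<Rightarrow> 'a::ab_group_add"
  assumes antisym: "\<And>i j. f i j = - f j i" and diag: "f (Suc c) (Suc c) = 0"
  shows "(\<Sum>i = 1..c. \<Sum>j = Suc c..Suc c + m - i. f i j)
    = (\<Sum>i = 1..Suc c. \<Sum>j = Suc (Suc c)..Suc c + m - i. f i j) - (\<Sum>j = 1..m. f (Suc c) j)"
proof -
  have split_first_column: "(\<Sum>j = Suc c..Suc c + m - i. f i j)
      = (\<Sum>j = Suc (Suc c)..Suc c + m - i. f i j) + (if i \<le> m then f i (Suc c) else 0)" for i
    by (auto simp: sum.atLeast_Suc_atMost)
  have "(\<Sum>j = 1..m. f (Suc c) j)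
      = (\<Sum>j\<in>{1..min c m}. f (Suc c) j) + (\<Sum>j = Suc (Suc c)..m. f (Suc c) j)"
  proof -
    have "(\<Sum>j = 1..m. f (Suc c) j)
        = (\<Sum>j\<in>{1..min c m} \<union> {Suc (Suc c)..m}. f (Suc c) j)"
      using diag by (intro sum.mono_neutral_right) (auto simp: not_less_eq_eq le_Suc_eq)
    also have "\<dots> = (\<Sum>j\<in>{1..min c m}. f (Suc c) j) + (\<Sum>j = Suc (Suc c)..m. f (Suc c) j)"
      by (intro sum.union_disjoint) auto
    finally show ?thesis .
  qed
  moreover have "(\<Sum>i = 1..c. if i \<le> m then f i (Suc c) else 0)
      = - (\<Sum>i\<in>{1..min c m}. f (Suc c) i)"
    unfolding sum_negf[symmetric] by (rule sum.mono_neutral_cong_right) (auto intro: antisym)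
  ultimately show ?thesis
    unfolding split_first_column sum.distrib by simp
qed

lemma barbell_expansion_Suc:
  fixes e :: "nat \<Rightarrow> 'a::comm_ring_1"
  assumes "1 \<le> a" "a \<le> m"
  shows "barbell_expansion e a c (Suc c + m)
    = barbell_expansion e a (Suc c) (Suc c + m) + of_nat c * (e (Suc c) * barbell_expansion e a 0 m)"
proof -
  define n where "n = Suc c + m"
  define P where "P = tail_sum e a"
  define f where "f i j = of_int (int j - int i) * e i * e j * P (n - i - j)" for i j
  have double_sum_Suc: "(\<Sum>i = 1..c. \<Sum>j = Suc c..n - i. f i j)
      = (\<Sum>i = 1..Suc c. \<Sum>j = Suc (Suc c)..n - i. f i j) - (\<Sum>j = 1..m. f (Suc c) j)"
    unfolding n_def by (rule sum_rectangle_Suc_antisymmetric) (simp_all add: f_def algebra_simps)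
  have "barbell_expansion e a c n - barbell_expansion e a (Suc c) n
      = of_nat (Suc c) * e (Suc c) * P m - (\<Sum>j = 1..m. f (Suc c) j)"
    using barbell_expansion_eq_tail_sums[of a c n e] barbell_expansion_eq_tail_sums[of a "Suc c" n e]
      assms double_sum_Suc
    by (simp add: n_def P_def f_def sum.atLeast_Suc_atMost)
  also have "\<dots> = (\<Sum>j = 1..m. of_nat c * (e (Suc c) * (of_nat j * e j * P (m - j))))"
    unfolding P_def tail_sum_rec[OF assms] sum_distrib_left sum_subtractf[symmetric]
    by (intro sum.cong refl) (simp add: f_def n_def P_def algebra_simps)
  also have "\<dots> = of_nat c * (e (Suc c) * barbell_expansion e a 0 m)"
    using assms by (simp add: barbell_expansion_eq_tail_sums P_def sum_distrib_left)
  finally show ?thesis by (simp add: n_def algebra_simps)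
qed

lemma barbell_expansion_no_path:
  fixes e :: "nat \<Rightarrow> 'a::comm_ring_1"
  assumes "1 \<le> a"
  shows "barbell_expansion e a c (a + c) = of_nat (a + c) * e (a + c)
    + (\<Sum>r = 1..min c (a - 1). of_int (int (a + c) - 2 * int r) * (e r * e (a + c - r)))"
proof -
  let ?n = "a + c" and ?P = "tail_sum e a"
  have "?P (?n - i) = 0" if "i \<in> {Suc c..?n} - {?n}" for i
    using that by (intro tail_sum_eq_0) auto
  then have "(\<Sum>i = Suc c..?n. of_nat i * e i * ?P (?n - i)) = (\<Sum>i\<in>{?n}. of_nat i * e i * ?P (?n - i))"
    using assms by (intro sum.mono_neutral_right ballI) simp_all
  moreover have "(\<Sum>i = 1..c. \<Sum>j = Suc c..?n - i. of_int (int j - int i) * e i * e j * ?P (?n - i - j))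
      = (\<Sum>i = 1..min c (a - 1). of_int (int ?n - 2 * int i) * (e i * e (?n - i)))"
  proof (rule sum.mono_neutral_cong_right)
    fix i assume i: "i \<in> {1..min c (a - 1)}"
    have "?P (?n - i - j) = 0" if "j \<in> {Suc c..?n - i} - {?n - i}" for j
      using that i by (intro tail_sum_eq_0) auto
    then have "(\<Sum>j = Suc c..?n - i. of_int (int j - int i) * e i * e j * ?P (?n - i - j))
        = (\<Sum>j\<in>{?n - i}. of_int (int j - int i) * e i * e j * ?P (?n - i - j))"
      using i by (intro sum.mono_neutral_right ballI) auto
    with i show "(\<Sum>j = Suc c..?n - i. of_int (int j - int i) * e i * e j * ?P (?n - i - j))
        = of_int (int ?n - 2 * int i) * (e i * e (?n - i))"
      by (simp add: tail_sum_0 algebra_simps)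
  qed (use assms in auto)
  ultimately show ?thesis
    using assms by (simp add: barbell_expansion_eq_tail_sums tail_sum_0)
qed

subsection \<open>Barbells and lollipops\<close>

definition lollipop_sum :: "('c \<Rightarrow> 'a::comm_ring_1) \<Rightarrow> 'c set \<Rightarrow> nat \<Rightarrow> nat \<Rightarrow> 'c \<Rightarrow> 'a" where
  "lollipop_sum x C a b =
     rooted_chromatic_sum x C (barbell_verts a b 0) (barbell_edges a b 0) (barbell_path_vertex a b)"

lemma finite_barbell_verts: "finite (barbell_verts a b c)"
  by (simp add: barbell_verts_def)

lemma barbell_path_vertex_mem:
  assumes "a \<ge> 1" "j \<le> b"
  shows "barbell_path_vertex a j \<in> barbell_verts a b c"
  using assms by (auto simp: barbell_path_vertex_def barbell_verts_def)

lemma clique_edges_singleton: "clique_edges {u} = {}"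
  by (auto simp: clique_edges_def)

lemma Union_lollipop_edges_subset:
  assumes "a \<ge> 1"
  shows "\<Union>(barbell_edges a b 0) \<subseteq> barbell_verts a b 0"
proof -
  have "\<Union>(clique_edges (R ` {1..a})) \<subseteq> barbell_verts a b 0"
    by (auto simp: clique_edges_def barbell_verts_def)
  moreover have "{barbell_path_vertex a j, barbell_path_vertex a (Suc j)} \<subseteq> barbell_verts a b 0"
    if "j < b" for j
    using that assms by (simp add: barbell_path_vertex_mem)
  ultimately show ?thesis
    unfolding barbell_edges_def by (simp add: clique_edges_singleton) blast
qed

lemma lollipop_sum_0:
  assumes "finite C" "a \<ge> 1" "i \<in> C"
  shows "lollipop_sum x C a 0 i = of_nat (fact (a - 1)) * (x i * esym x (C - {i}) (a - 1))"
proof -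
  let ?W = "R ` {1..<a}"
  have cliques: "barbell_verts a 0 0 = {R a} \<union> ?W"
    "barbell_edges a 0 0 = {} \<union> clique_edges (insert (R a) ?W)"
  proof -
    have "R ` {1..a} = insert (R a) ?W" using assms by force
    then show "barbell_verts a 0 0 = {R a} \<union> ?W"
      "barbell_edges a 0 0 = {} \<union> clique_edges (insert (R a) ?W)"
      by (simp_all add: barbell_verts_def barbell_edges_def barbell_path_vertex_def
          clique_edges_singleton)
  qed
  have "lollipop_sum x C a 0 i
      = rooted_chromatic_sum x C ({R a} \<union> ?W) ({} \<union> clique_edges (insert (R a) ?W)) (R a) i"
    unfolding lollipop_sum_def cliques by (simp only: barbell_path_vertex_def refl if_True)
  also have "\<dots> = x i * (of_nat (fact (a - 1)) * esym x (C - {i}) (a - 1))"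
    using assms
    by (subst rooted_chromatic_sum_attach_clique)
       (auto simp: rooted_chromatic_sum_single_vertex card_image inj_on_def)
  finally show ?thesis by (simp add: mult.left_commute)
qed

lemma lollipop_sum_Suc:
  assumes "finite C" "a \<ge> 1" "i \<in> C"
  shows "lollipop_sum x C a (Suc b) i = x i * (\<Sum>j\<in>C - {i}. lollipop_sum x C a b j)"
proof -
  let ?p = "barbell_path_vertex a"
  have "barbell_verts a (Suc b) 0 = insert (?p (Suc b)) (barbell_verts a b 0)"
    by (auto simp: barbell_verts_def barbell_path_vertex_def atLeastAtMostSuc_conv)
  moreover have "barbell_edges a (Suc b) 0 = insert {?p b, ?p (Suc b)} (barbell_edges a b 0)"
    by (auto simp: barbell_edges_def clique_edges_singleton less_Suc_eq)
  moreover have "?p (Suc b) \<notin> barbell_verts a b 0"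
    by (auto simp: barbell_verts_def barbell_path_vertex_def)
  ultimately show ?thesis
    unfolding lollipop_sum_def
    using assms finite_barbell_verts Union_lollipop_edges_subset barbell_path_vertex_mem
    by (simp add: rooted_chromatic_sum_attach_edge)
qed

lemma chromatic_sum_barbell_eq_lollipop_sums:
  assumes "finite C" "a \<ge> 1"
  shows "chromatic_sum x C (barbell_verts a b c) (barbell_edges a b c)
    = of_nat (fact c) * (\<Sum>i\<in>C. lollipop_sum x C a b i * esym x (C - {i}) c)"
proof -
  let ?V = "barbell_verts a b 0" and ?W = "T ` {1..c}" and ?p = "barbell_path_vertex a b"
  have verts: "barbell_verts a b c = ?V \<union> ?W" "?V \<inter> ?W = {}"
    by (auto simp: barbell_verts_def)
  have edges: "barbell_edges a b c = barbell_edges a b 0 \<union> clique_edges (insert ?p ?W)"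
    by (simp add: barbell_edges_def clique_edges_singleton)
  have root: "?p \<in> ?V" using assms by (simp add: barbell_path_vertex_mem)
  have "chromatic_sum x C (barbell_verts a b c) (barbell_edges a b c)
      = (\<Sum>i\<in>C. rooted_chromatic_sum x C (?V \<union> ?W)
          (barbell_edges a b 0 \<union> clique_edges (insert ?p ?W)) ?p i)"
    unfolding verts(1) edges using assms root finite_barbell_verts
    by (intro chromatic_sum_by_root_color) auto
  also have "\<dots> = (\<Sum>i\<in>C. lollipop_sum x C a b i * (of_nat (fact c) * esym x (C - {i}) c))"
    using assms root verts(2) finite_barbell_verts Union_lollipop_edges_subset
    by (simp add: rooted_chromatic_sum_attach_clique lollipop_sum_def card_image inj_on_def)
  finally show ?thesis by (simp add: sum_distrib_left mult.left_commute)
qed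

lemma sum_esym_remove_eq_barbell_expansion:
  fixes x :: "'c \<Rightarrow> 'a::comm_ring_1"
  assumes "finite C" "1 \<le> a"
  shows "(\<Sum>i\<in>C. x i * esym x (C - {i}) (a - 1) * esym x (C - {i}) c)
    = barbell_expansion (esym x C) a c (a + c)"
proof -
  have expansion: "(\<Sum>i\<in>C. x i * esym x (C - {i}) p * esym x (C - {i}) q)
      = barbell_expansion (esym x C) a c (a + c)"
    if "p + q + 1 = a + c" "q = min c (a - 1)" for p q
    unfolding sum_esym_remove_esym_remove[OF assms(1)] barbell_expansion_no_path[OF assms(2)] that(1)
    by (simp add: that(2))
  show ?thesis
  proof (cases "c \<le> a - 1")
    case True
    then show ?thesis using expansion[of "a - 1" c] assms by simp
  next
    case False
    then show ?thesis using expansion[of c "a - 1"] assms by (simp add: mult_ac)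
  qed
qed

lemma sum_lollipop_esym_remove_eq_barbell_expansion:
  fixes x :: "'c \<Rightarrow> 'a::comm_ring_1"
  assumes "finite C" "1 \<le> a"
  shows "(\<Sum>i\<in>C. lollipop_sum x C a b i * esym x (C - {i}) c)
    = of_nat (fact (a - 1)) * barbell_expansion (esym x C) a c (a + b + c)"
proof (induction b arbitrary: c)
  case 0
  then show ?case
    using sum_esym_remove_eq_barbell_expansion[OF assms, of x c, symmetric] assms
    by (simp add: lollipop_sum_0 sum_distrib_left mult.assoc)
next
  case (Suc b)
  let ?w = "lollipop_sum x C a b" and ?Y = "\<lambda>c n. barbell_expansion (esym x C) a c n"
  have "(\<Sum>i\<in>C. lollipop_sum x C a (Suc b) i * esym x (C - {i}) c)
      = (\<Sum>i\<in>C. x i * (\<Sum>j\<in>C - {i}. ?w j) * esym x (C - {i}) c)"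
    using assms by (simp add: lollipop_sum_Suc)
  also have "\<dots> = (\<Sum>i\<in>C. ?w i * esym x (C - {i}) (Suc c))
      + of_nat c * (esym x C (Suc c) * (\<Sum>i\<in>C. ?w i * esym x (C - {i}) 0))"
    using assms by (simp add: sum_attach_edge_esym_remove esym_0)
  also have "\<dots> = of_nat (fact (a - 1)) * ?Y (Suc c) (Suc c + (a + b))
      + of_nat c * (esym x C (Suc c) * (of_nat (fact (a - 1)) * ?Y 0 (a + b)))"
    by (simp add: Suc.IH add_ac)
  also have "\<dots> = of_nat (fact (a - 1)) * ?Y c (Suc c + (a + b))"
    using barbell_expansion_Suc[OF assms(2), of "a + b" "esym x C" c]
    by (simp add: algebra_simps)
  finally show ?case by (simp add: add_ac)
qed

lemma chromatic_sum_barbell_eq_expansion: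
  assumes "finite C" "1 \<le> a"
  shows "chromatic_sum x C (barbell_verts a b c) (barbell_edges a b c)
    = of_nat (fact (a - 1) * fact c) * barbell_expansion (esym x C) a c (a + b + c)"
  using assms
  by (simp add: chromatic_sum_barbell_eq_lollipop_sums sum_lollipop_esym_remove_eq_barbell_expansion
      mult_ac)

subsection \<open>From finitely many to all colours\<close>

definition agree_on :: "nat set \<Rightarrow> 'a mseries \<Rightarrow> 'a mseries \<Rightarrow> bool" where
  "agree_on D f g \<longleftrightarrow> (\<forall>M. set_mset M \<subseteq> D \<longrightarrow> mcoeff f M = mcoeff g M)"

lemma agree_on_refl: "agree_on D f f"
  by (simp add: agree_on_def)

lemma agree_on_add:
  fixes f g f' g' :: "'a::comm_ring_1 mseries"
  assumes "agree_on D f f'" "agree_on D g g'"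
  shows "agree_on D (f + g) (f' + g')"
  using assms by (simp add: agree_on_def plus_mseries.rep_eq)

lemma agree_on_mult:
  fixes f g f' g' :: "'a::comm_ring_1 mseries"
  assumes "agree_on D f f'" "agree_on D g g'"
  shows "agree_on D (f * g) (f' * g')"
  unfolding agree_on_def times_mseries.rep_eq
proof (intro allI impI sum.cong refl)
  fix M P :: "nat multiset" assume M: "set_mset M \<subseteq> D" and "P \<in> {P. P \<subseteq># M}"
  then have "set_mset P \<subseteq> D" "set_mset (M - P) \<subseteq> D"
    by (auto dest: mset_subset_eqD in_diffD)
  then show "mcoeff f P * mcoeff g (M - P) = mcoeff f' P * mcoeff g' (M - P)"
    using assms by (simp add: agree_on_def)
qed

lemma agree_on_sum:
  fixes f g :: "'i \<Rightarrow> 'a::comm_ring_1 mseries"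
  assumes "\<And>i. i \<in> A \<Longrightarrow> agree_on D (f i) (g i)"
  shows "agree_on D (\<Sum>i\<in>A. f i) (\<Sum>i\<in>A. g i)"
  using assms
  by (induction A rule: infinite_finite_induct) (simp_all add: agree_on_refl agree_on_add)

lemma agree_on_prod_list:
  fixes f g :: "'i \<Rightarrow> 'a::comm_ring_1 mseries"
  assumes "\<And>i. agree_on D (f i) (g i)"
  shows "agree_on D (\<Prod>i\<leftarrow>I. f i) (\<Prod>i\<leftarrow>I. g i)"
  by (induction I) (simp_all add: assms agree_on_refl agree_on_mult)

lemma agree_on_barbell_expansion:
  fixes e e' :: "nat \<Rightarrow> 'a::comm_ring_1 mseries"
  assumes "\<And>k. agree_on D (e k) (e' k)"
  shows "agree_on D (barbell_expansion e a c n) (barbell_expansion e' a c n)"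
  unfolding barbell_expansion_def
  by (intro agree_on_add agree_on_sum agree_on_mult agree_on_prod_list agree_on_refl assms)

lemma mcoeff_sum:
  "mcoeff (\<Sum>i\<in>A. f i :: 'a::comm_ring_1 mseries) M = (\<Sum>i\<in>A. mcoeff (f i) M)"
  by (induction A rule: infinite_finite_induct) (simp_all add: zero_mseries.rep_eq plus_mseries.rep_eq)

lemma agree_on_formal_sum:
  fixes f :: "'i \<Rightarrow> 'a::comm_ring_1 mseries"
  assumes "finite B" "B \<subseteq> A"
    and vanish: "\<And>i M. i \<in> A - B \<Longrightarrow> set_mset M \<subseteq> D \<Longrightarrow> mcoeff (f i) M = 0"
  shows "agree_on D (formal_sum A f) (\<Sum>i\<in>B. f i)"
  unfolding agree_on_def formal_sum.rep_eq mcoeff_sum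
  using assms by (intro allI impI sum.mono_neutral_left) auto

lemma elem_sym_agree_on_esym:
  assumes "finite D"
  shows "agree_on D (elem_sym k :: 'a::comm_ring_1 mseries) (esym var (D \<inter> {1..}) k)"
  unfolding elem_sym_def esym_def
  using assms by (intro agree_on_formal_sum) (auto simp: prod_var_eq intro: finite_subset)

lemma chromatic_sym_agree_on_chromatic_sum:
  assumes "finite D" "finite V"
  shows "agree_on D (chromatic_sym V E :: 'a::comm_ring_1 mseries) (chromatic_sum var (D \<inter> {1..}) V E)"
  unfolding chromatic_sym_def chromatic_sum_def coloring_sum_def
proof (rule agree_on_formal_sum)
  show "finite (proper_colorings_in (D \<inter> {1..}) V E)"
    using assms by (simp add: finite_proper_colorings_in)
  show "proper_colorings_in (D \<inter> {1..}) V E \<subseteq> proper_colorings V E"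
    by (auto simp: proper_colorings_in_def proper_colorings_def)
  fix \<kappa> and M :: "nat multiset"
  assume \<kappa>: "\<kappa> \<in> proper_colorings V E - proper_colorings_in (D \<inter> {1..}) V E" and M: "set_mset M \<subseteq> D"
  from \<kappa> obtain v where "v \<in> V" "\<kappa> v \<notin> D"
    by (auto simp: proper_colorings_in_def proper_colorings_def PiE_iff)
  moreover have "\<kappa> v \<in># image_mset \<kappa> (mset_set V)" if "v \<in> V" for v
    using that assms(2) by simp
  ultimately have "M \<noteq> image_mset \<kappa> (mset_set V)" using M by blast
  then show "mcoeff (\<Prod>v\<in>V. var (\<kappa> v) :: 'a mseries) M = 0"
    using assms(2) by (simp add: prod_var_eq)
qed

theorem theorem3p7:
  fixes a b c n :: nat
  assumes "a \<ge> 1" and "n = a + b + c"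
  shows "(chromatic_sym (barbell_verts a b c) (barbell_edges a b c) :: int mseries) =
    of_nat (fact (a - 1) * fact c) *
      ((\<Sum>I | I \<in> compositions n \<and> last I \<ge> a \<and> hd I \<ge> c + 1.
          of_int (comp_weight I) * elem_sym_list I)
     + (\<Sum>I | I \<in> compositions n \<and> length I \<ge> 2 \<and> last I \<ge> a \<and> hd I \<le> c \<and> c < I ! 1.
          of_int ((int (I ! 1) - int (hd I)) * (\<Prod>i\<leftarrow>drop 2 I. int i - 1)) * elem_sym_list I))"
  unfolding elem_sym_list_def barbell_expansion_def[symmetric]
proof (rule mseries_eqI)
  fix M :: "nat multiset"
  let ?D = "set_mset M"
  let ?C = "?D \<inter> {1..}"
  let ?X = "chromatic_sym (barbell_verts a b c) (barbell_edges a b c) :: int mseries"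
  let ?k = "of_nat (fact (a - 1) * fact c) :: int mseries"
  have "agree_on ?D ?X (chromatic_sum var ?C (barbell_verts a b c) (barbell_edges a b c))"
    by (intro chromatic_sym_agree_on_chromatic_sum finite_barbell_verts) simp
  then have "agree_on ?D ?X (?k * barbell_expansion (esym var ?C) a c n)"
    using assms by (simp add: chromatic_sum_barbell_eq_expansion)
  moreover have "agree_on ?D (?k * barbell_expansion elem_sym a c n)
      (?k * barbell_expansion (esym var ?C) a c n)"
    by (intro agree_on_mult agree_on_refl agree_on_barbell_expansion elem_sym_agree_on_esym) simp
  ultimately show "mcoeff ?X M = mcoeff (?k * barbell_expansion elem_sym a c n) M"
    by (simp add: agree_on_def)
qed

end
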